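(* Let $n\ge2$. Suppose the sequence $(\varepsilon_j)_{j\in\mathbb{N}}\subset(0,1)$, that $(\ell_j)_{j\in\mathbb{N}}\subset(0,\infty)$ is decreasing, and that $$V:=\sum_{j=1}^\infty\ell_j^n<\infty\quad\text{and}\quad a>\ell_1+(V-\ell_1^n)^{1/n}.$$ Then there exists a choice of the sequence of translations $(t_j)_{j\in\mathbb{N}}\subset\mathbb{R}^n$ such that the sequences $(\mathcal{O}_j)_{j\in\mathbb{N}}$ and $(\Gamma_j)_{j\in\mathbb{N}}$, defined by $$\mathcal{O}_j:=\ell_j\mathcal{O}+t_j\quad\text{and}\quad\Gamma_j:=\ell_j\Gamma^{\varepsilon_j}+t_j,\qquad j\in\mathbb{N},$$ satisfy: (i) $\overline{\mathcal{O}_i}\cap\overline{\mathcal{O}_j}=\varnothing$ for $i\neq j$ (and hence $\Gamma_i\cap\Gamma_j=\varnothing$ for $i\ne j$); (ii) $\mathcal{O}_\infty:=\bigcup_{j=1}^\infty\mathcal{O}_j$ is bounded, so that $\Gamma:=\overline{\bigcup_{j=1}^\infty\Gamma_j}\subset\partial\mathcal{O}_\infty$ is compact; (iii) $\Omega:=\mathbb{R}^n\setminus\Gamma$ is connected; and, moreover, $\mathcal{O}_\infty\subset a\mathcal{O}$.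
   Context: For $S\subset\mathbb{R}^n$, $\ell>0$, $t\in\mathbb{R}^n$: $\ell S+t:=\{\ell x+t:x\in S\}$. $\mathcal{O}:=\{x=(x_1,\dots,x_n)\in\mathbb{R}^n:0<x_i<1\text{ for }i=1,\dots,n\}$ is the open unit cube. For $0<\varepsilon<1$, $\Gamma^\varepsilon:=\partial\mathcal{O}\setminus\{x=(x_1,\dots,x_n)\in\mathbb{R}^n:x_n=0\text{ and }0<x_i<\varepsilon\text{ for }i=1,\dots,n-1\}$, i.e. $\partial\mathcal{O}$ with an $(n-1)$-dimensional open cube of sidelength $\varepsilon$ removed from one face. *)

theory Defs
  imports "HOL-Analysis.Analysis"
begin

text \<open>
  Points of n-dimensional space are elements of \<open>real ^ 'n\<close> with \<open>n = CARD('n)\<close>.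
  Since the index type carries no order, the label of the coordinate called \<open>x\<^sub>n\<close> in the
  usual numbering is passed explicitly as \<open>k :: 'n\<close> where it matters.
\<close>

definition scale_translate :: "real \<Rightarrow> (real ^ 'n) set \<Rightarrow> real ^ 'n \<Rightarrow> (real ^ 'n) set" where
  "scale_translate l S t = (\<lambda>x. l *\<^sub>R x + t) ` S"

definition open_unit_cube :: "(real ^ 'n) set" where
  "open_unit_cube = {x. \<forall>i. 0 < x $ i \<and> x $ i < 1}"

text \<open>
  The boundary of the unit cube with an open \<open>(n - 1)\<close>-dimensional cube of side \<open>\<epsilon>\<close>
  removed from the face \<open>x\<^sub>k = 0\<close>.
\<close>

definition pierced_boundary :: "'n \<Rightarrow> real \<Rightarrow> (real ^ 'n) set" where
  "pierced_boundary k \<epsilon> =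
     frontier open_unit_cube - {x. x $ k = 0 \<and> (\<forall>i. i \<noteq> k \<longrightarrow> 0 < x $ i \<and> x $ i < \<epsilon>)}"

end

theory Submission
  imports Defs
begin

text \<open>
  Meir--Moser: decreasing cubes are packed greedily into layers, each layer being a packing one
  dimension lower whose height is the side of its first cube. To control where infinitely many cubes
  accumulate, the sequence is cut into finite blocks, each packed into a cube of its own, and these
  cubes are strung along a diagonal; the only accumulation point is then a corner. The strict
  inequality for \<open>a\<close> leaves room to enlarge all sides by a factor \<open>c > 1\<close> before packing, so each
  closed cube sits in an open set disjoint from the other cubes. Hence each component of \<open>\<Gamma>\<close> lies
  in one pierced boundary or is the corner. Neither separates space, and a closed set that separates
  space has a component that does.
\<close>

section \<open>Packing finitely many cubes into a box\<close>

text \<open>\<open>p j\<close> is the least corner of a cube of side \<open>x j\<close>; overlap is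
  excluded by asking for a coordinate direction that separates the two cubes. Coordinates range over
  a variable set \<open>I\<close> so that an induction on the dimension can drop a
  direction.\<close>

definition cube_packing ::
    "nat set \<Rightarrow> 'i set \<Rightarrow> (nat \<Rightarrow> real) \<Rightarrow> ('i \<Rightarrow> real) \<Rightarrow> (nat \<Rightarrow> 'i \<Rightarrow> real) \<Rightarrow> bool" where
  "cube_packing J I x a p \<longleftrightarrow>
     (\<forall>j\<in>J. \<forall>i\<in>I. 0 \<le> p j i \<and> p j i + x j \<le> a i) \<and>
     (\<forall>j\<in>J. \<forall>j'\<in>J. j \<noteq> j' \<longrightarrow> (\<exists>i\<in>I. p j i + x j \<le> p j' i \<or> p j' i + x j' \<le> p j i))"

lemma cube_packing_bounds:
  assumes "cube_packing J I x a p" "j \<in> J" "i \<in> I"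
  shows "0 \<le> p j i \<and> p j i + x j \<le> a i"
  using assms by (simp add: cube_packing_def)

lemma cube_packing_separated:
  assumes "cube_packing J I x a p" "j \<in> J" "j' \<in> J" "j \<noteq> j'"
  shows "\<exists>i\<in>I. p j i + x j \<le> p j' i \<or> p j' i + x j' \<le> p j i"
  using assms by (simp add: cube_packing_def)

text \<open>
  The volume condition survives removing a maximal layer: \<open>k\<close> is the first cube that no longer
  fits into the layer started by cube \<open>m\<close>, and \<open>h\<close> is the height of the box.
\<close>
lemma meir_moser_remaining_bound:
  fixes x :: "nat \<Rightarrow> real" and a :: "'i \<Rightarrow> real"
  assumes pos: "\<And>j. 0 < x j" and dec: "decseq x"
    and mk: "m < k" "k < N"
    and aF: "\<And>i. i \<in> F \<Longrightarrow> x m \<le> a i"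
    and vol: "(\<Sum>j=m..<N. x j ^ Suc n) \<le> x m ^ Suc n + (\<Prod>i\<in>F. a i - x m) * (h - x m)"
    and full: "x m ^ n + (\<Prod>i\<in>F. a i - x m) < (\<Sum>j=m..<Suc k. x j ^ n)"
  shows "x k \<le> h - x m"
    and "(\<Sum>j=k..<N. x j ^ Suc n) \<le> x k ^ Suc n + (\<Prod>i\<in>F. a i - x k) * (h - x m - x k)"
proof -
  define P where "P = (\<Prod>i\<in>F. a i - x m)"
  have xkm: "x k \<le> x m" using dec mk by (simp add: decseqD)
  have P0: "0 \<le> P" unfolding P_def by (rule prod_nonneg) (use aF in auto)
  have PP: "P \<le> (\<Prod>i\<in>F. a i - x k)"
    unfolding P_def by (rule prod_mono) (use aF xkm in auto)
  have s1: "(\<Sum>j=m..<Suc k. x j ^ n) = x m ^ n + (\<Sum>j=Suc m..<Suc k. x j ^ n)"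
    using mk by (subst sum.atLeast_Suc_lessThan) auto
  have s2: "(\<Sum>j=m..<N. x j ^ Suc n) = x m ^ Suc n + (\<Sum>j=Suc m..<Suc k. x j ^ Suc n)
      + (\<Sum>j=Suc k..<N. x j ^ Suc n)"
    using mk by (subst sum.atLeast_Suc_lessThan)
      (auto simp: sum.atLeastLessThan_concat[of "Suc m" "Suc k" N, symmetric] simp del: sum.op_ivl_Suc)
  have s3: "(\<Sum>j=k..<N. x j ^ Suc n) = x k ^ Suc n + (\<Sum>j=Suc k..<N. x j ^ Suc n)"
    using mk by (subst sum.atLeast_Suc_lessThan) auto
  \<comment> \<open>The overflow of the layer is turned into volume: cubes \<open>Suc m\<close> to
    \<open>k\<close> have side at least \<open>x k\<close>, so \<open>x k * x j ^ n\<close> is at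
    most the volume \<open>x j ^ Suc n\<close>.\<close>
  have "x k * P < x k * (\<Sum>j=Suc m..<Suc k. x j ^ n)"
    using full s1 pos[of k] unfolding P_def by simp
  also have "\<dots> \<le> (\<Sum>j=Suc m..<Suc k. x j ^ Suc n)"
    unfolding sum_distrib_left
  proof (rule sum_mono)
    fix j assume "j \<in> {Suc m..<Suc k}"
    then have "x k \<le> x j" using dec by (simp add: decseqD)
    then show "x k * x j ^ n \<le> x j ^ Suc n" using pos[of j] by (simp add: mult_right_mono)
  qed
  finally have lt: "(\<Sum>j=Suc k..<N. x j ^ Suc n) < P * (h - x m - x k)"
    using vol s2 unfolding P_def[symmetric] by (simp add: algebra_simps)
  \<comment> \<open>The remaining volume is nonnegative yet strictly below
    \<open>P * (h - x m - x k)\<close>; as \<open>P\<close> is nonnegative, this forces cube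
    \<open>k\<close> to fit above the layer.\<close>
  moreover have "0 \<le> (\<Sum>j=Suc k..<N. x j ^ Suc n)"
    by (intro sum_nonneg zero_le_power less_imp_le[OF pos])
  ultimately have "0 < P * (h - x m - x k)" by linarith
  with P0 have hp: "0 < h - x m - x k" by (simp add: zero_less_mult_iff)
  then show "x k \<le> h - x m" by simp
  have "P * (h - x m - x k) \<le> (\<Prod>i\<in>F. a i - x k) * (h - x m - x k)"
    using PP hp by (intro mult_right_mono) auto
  with lt s3 show "(\<Sum>j=k..<N. x j ^ Suc n) \<le> x k ^ Suc n + (\<Prod>i\<in>F. a i - x k) * (h - x m - x k)"
    by linarith
qed

text \<open>Outer induction on the dimension, inner induction on the number \<open>N - m\<close> of
  cubes left. The first cubes form a layer of height \<open>x m\<close> in direction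
  \<open>i0\<close>, arranged by the lower-dimensional packing; the rest go into the box shortened
  by \<open>x m\<close>, where the volume condition holds again.\<close>

theorem meir_moser:
  fixes x :: "nat \<Rightarrow> real" and a :: "'i \<Rightarrow> real"
  assumes "finite I" "I \<noteq> {}"
    and pos: "\<And>j. 0 < x j" and dec: "decseq x"
    and "m < N"
    and "\<And>i. i \<in> I \<Longrightarrow> x m \<le> a i"
    and "(\<Sum>j=m..<N. x j ^ card I) \<le> x m ^ card I + (\<Prod>i\<in>I. a i - x m)"
  shows "\<exists>p. cube_packing {m..<N} I x a p"
  using assms(1,2,5-)
proof (induction I arbitrary: m N a rule: finite_ne_induct)
  case (singleton i)
  \<comment> \<open>In dimension one the cubes are intervals laid end to end, and the volume
    condition says that their total length is at most \<open>a i\<close>.\<close>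
  define p where "p = (\<lambda>j (_ :: 'i). \<Sum>t=m..<j. x t)"
  have step: "p j i + x j \<le> p j' i" if "m \<le> j" "j < j'" for j j'
  proof -
    have "p j i + x j = (\<Sum>t=m..<Suc j. x t)" using that by (simp add: p_def)
    also have "\<dots> \<le> p j' i"
      unfolding p_def by (rule sum_mono2) (use that pos in \<open>auto intro: less_imp_le\<close>)
    finally show ?thesis .
  qed
  have "p N i \<le> a i" using singleton by (simp add: p_def)
  moreover have "0 \<le> p j i" for j
    unfolding p_def by (intro sum_nonneg less_imp_le[OF pos])
  ultimately have "cube_packing {m..<N} {i} x a p"
    unfolding cube_packing_def
    by (auto simp: neq_iff intro: step order_trans[OF step[of _ N]])
  then show ?case by blast
next
  case (insert i0 F)
  define n where "n = card F"
  have cI: "card (insert i0 F) = Suc n" using insert by (simp add: n_def)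
  have prI: "(\<Prod>i\<in>insert i0 F. g i) = (\<Prod>i\<in>F. g i) * g i0" for g :: "'i \<Rightarrow> real"
    using insert by (simp add: mult.commute)
  from insert.prems show ?case
  proof (induction "N - m" arbitrary: m a rule: less_induct)
    case less
    \<comment> \<open>\<open>c k\<close> is the volume condition, one dimension lower, for cubes
      \<open>m\<close> to \<open>k - 1\<close>; the greatest such \<open>k\<close> gives a layer
      that cannot be extended.\<close>
    define c where "c k \<longleftrightarrow> m < k \<and> k \<le> N \<and>
      (\<Sum>j=m..<k. x j ^ n) \<le> x m ^ n + (\<Prod>i\<in>F. a i - x m)" for k
    have "0 \<le> (\<Prod>i\<in>F. a i - x m)" by (rule prod_nonneg) (use less.prems in auto)
    then have "c (Suc m)" using less.prems by (simp add: c_def)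
    moreover have "\<And>k'. c k' \<Longrightarrow> k' \<le> N" by (simp add: c_def)
    ultimately obtain k where k: "c k" and kmax: "\<And>k'. c k' \<Longrightarrow> k' \<le> k"
      using GreatestI_nat[of c] Greatest_le_nat[of c] by blast
    obtain p1 where p1: "cube_packing {m..<k} F x a p1"
      using insert.IH[of m k a] k less.prems by (auto simp: c_def n_def)
    have "\<exists>p. cube_packing {k..<N} (insert i0 F) x (a(i0 := a i0 - x m)) p"
    proof (cases "k = N")
      case True
      then show ?thesis by (simp add: cube_packing_def)
    next
      case False
      with k have mk: "m < k" "k < N" by (auto simp: c_def)
      have full: "x m ^ n + (\<Prod>i\<in>F. a i - x m) < (\<Sum>j=m..<Suc k. x j ^ n)"
      proof (rule ccontr)
        assume "\<not> ?thesis"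
        then have "c (Suc k)" using mk unfolding c_def by linarith
        then show False using kmax[of "Suc k"] by simp
      qed
      have vol: "(\<Sum>j=m..<N. x j ^ Suc n) \<le> x m ^ Suc n + (\<Prod>i\<in>F. a i - x m) * (a i0 - x m)"
        using less.prems(3) by (simp only: cI prI)
      have aF: "x m \<le> a i" if "i \<in> F" for i using less.prems that by auto
      note b = meir_moser_remaining_bound[OF pos dec mk aF vol full]
      have xkm: "x k \<le> x m" using dec mk by (simp add: decseqD)
      have "(\<Prod>i\<in>F. (a(i0 := a i0 - x m)) i - x k) = (\<Prod>i\<in>F. a i - x k)"
        by (rule prod.cong) (use insert in auto)
      then show ?thesis
        using mk b aF xkm
        by (intro less.hyps) (auto simp: cI prI intro: order_trans simp del: power_Suc)
    qed
    then obtain p2 where p2: "cube_packing {k..<N} (insert i0 F) x (a(i0 := a i0 - x m)) p2" ..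
    \<comment> \<open>Layer cubes rest at height 0 in direction \<open>i0\<close>; all later cubes
      are lifted by the layer height \<open>x m\<close>, which no layer cube exceeds.\<close>
    define p where "p j = (if j < k then (p1 j)(i0 := 0) else (p2 j)(i0 := p2 j i0 + x m))" for j
    have xm: "x j \<le> x m" if "m \<le> j" for j using dec that by (simp add: decseqD)
    have "cube_packing {m..<N} (insert i0 F) x a p"
      unfolding cube_packing_def
    proof (intro conjI ballI impI)
      fix j i assume j: "j \<in> {m..<N}" and i: "i \<in> insert i0 F"
      have "x j \<le> a i0" using less.prems xm[of j] j by fastforce
      have b1: "0 \<le> p1 j i \<and> p1 j i + x j \<le> a i" if "j < k" "i \<in> F"
        using cube_packing_bounds[OF p1] j that by simp
      have b2: "0 \<le> p2 j i \<and> p2 j i + x j \<le> (a(i0 := a i0 - x m)) i" if "k \<le> j"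
        using cube_packing_bounds[OF p2, of j i] j i that by simp
      have "0 \<le> p j i \<and> p j i + x j \<le> a i"
      proof (cases "i = i0")
        case True
        then show ?thesis
          using b2 \<open>x j \<le> a i0\<close> pos[of m] by (cases "j < k") (auto simp: p_def)
      next
        case False
        then show ?thesis using b1 b2 i by (cases "j < k") (auto simp: p_def)
      qed
      then show "0 \<le> p j i" "p j i + x j \<le> a i" by blast+
    next
      fix j j' assume j: "j \<in> {m..<N}" "j' \<in> {m..<N}" "j \<noteq> j'"
      have sep: "\<exists>i\<in>insert i0 F. p j i + x j \<le> p j' i \<or> p j' i + x j' \<le> p j i"
        if jj: "j \<in> {m..<N}" "j' \<in> {m..<N}" "j < j'" for j j'
      proof -
        consider "j' < k" | "j < k" "k \<le> j'" | "k \<le> j" using that by linarith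
        then show ?thesis
        proof cases
          case 1
          then obtain i where "i \<in> F" "p1 j i + x j \<le> p1 j' i \<or> p1 j' i + x j' \<le> p1 j i"
            using cube_packing_separated[OF p1, of j j'] jj by auto
          then show ?thesis using 1 that insert.hyps by (intro bexI[of _ i]) (auto simp: p_def)
        next
          case 2
          then have "0 \<le> p2 j' i0" using cube_packing_bounds[OF p2, of j' i0] that by simp
          then show ?thesis using 2 that xm[of j] by (auto simp: p_def)
        next
          case 3
          then obtain i where "i \<in> insert i0 F"
              "p2 j i + x j \<le> p2 j' i \<or> p2 j' i + x j' \<le> p2 j i"
            using cube_packing_separated[OF p2, of j j'] jj by auto
          then show ?thesis using 3 that by (intro bexI[of _ i]) (auto simp: p_def)
        qed
      qed
      show "\<exists>i\<in>insert i0 F. p j i + x j \<le> p j' i \<or> p j' i + x j' \<le> p j i"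
        using sep[of j j'] sep[of j' j] j by (metis nat_neq_iff)
    qed
    then show ?case by blast
  qed
qed

section \<open>Packing infinitely many cubes towards a corner\<close>

text \<open>Block \<open>m\<close> gets a cube of side \<open>r 0 * q ^ m\<close>; these sides sum
  to \<open>a\<close>, and the block cubes touch corner to corner along the diagonal. Blocks are
  finite, so the block number tends to infinity and the positions are squeezed to the far
  corner.\<close>

lemma packing_to_corner:
  fixes x :: "nat \<Rightarrow> real" and V a :: real
  assumes pos: "\<And>j. 0 < x j" and dec: "decseq x"
    and V: "(\<lambda>j. x j ^ CARD('n)) sums V"
    and a: "x 0 + root CARD('n) (V - x 0 ^ CARD('n)) < a"
  obtains p :: "nat \<Rightarrow> 'n::finite \<Rightarrow> real"
  where "cube_packing UNIV UNIV x (\<lambda>_. a) p" "\<And>i. (\<lambda>j. p j i) \<longlonglongrightarrow> a"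
proof -
  define n where "n = CARD('n)"
  have n: "0 < n" by (simp add: n_def)
  \<comment> \<open>\<open>W m\<close> is the total volume after cube \<open>m\<close>, that cube
    excluded, and \<open>r m\<close> solves \<open>(r m - x m) ^ n = W m\<close>. So a cube of side
    \<open>r m\<close> meets the Meir--Moser condition for every finite stretch starting at
    \<open>m\<close>.\<close>
  define W where "W m = (\<Sum>j. x (j + Suc m) ^ n)" for m
  define r where "r m = x m + root n (W m)" for m
  have sm: "summable (\<lambda>j. x j ^ n)" using V by (auto simp: n_def sums_iff)
  have W0: "0 \<le> W m" for m
    unfolding W_def by (intro suminf_nonneg summable_ignore_initial_segment[OF sm])
      (use pos in \<open>auto intro: less_imp_le\<close>)
  have tail: "(\<Sum>j=m..<N. x j ^ n) \<le> x m ^ n + W m" if "m < N" for m N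
  proof -
    have "(\<Sum>j=m..<N. x j ^ n) = x m ^ n + (\<Sum>j=Suc m..<N. x j ^ n)"
      using that by (subst sum.atLeast_Suc_lessThan) auto
    moreover have "(\<Sum>j=Suc m..<N. x j ^ n) = (\<Sum>j<N - Suc m. x (j + Suc m) ^ n)"
      using that sum.shift_bounds_nat_ivl[of "\<lambda>j. x j ^ n" 0 "Suc m" "N - Suc m"]
      by (simp add: atLeast0LessThan)
    moreover have "\<dots> \<le> W m"
      unfolding W_def by (intro sum_le_suminf summable_ignore_initial_segment[OF sm])
        (use pos in \<open>auto intro: less_imp_le\<close>)
    ultimately show ?thesis by simp
  qed
  have rpos: "0 < r m" for m
    using pos[of m] W0[of m] n by (simp add: r_def add_pos_nonneg)
  have "W 0 = V - x 0 ^ n"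
    using suminf_split_head[OF sm] V by (simp add: W_def n_def sums_iff)
  then have r0a: "r 0 < a" using a by (simp add: r_def n_def)
  have "x \<longlonglongrightarrow> 0"
  proof -
    have "(\<lambda>j. root n (x j ^ n)) \<longlonglongrightarrow> root n 0"
      by (intro tendsto_real_root summable_LIMSEQ_zero[OF sm])
    then show ?thesis using n pos by (simp add: real_root_power_cancel less_imp_le)
  qed
  moreover have "(\<lambda>m. root n (W m)) \<longlonglongrightarrow> root n 0"
    unfolding W_def
    by (intro tendsto_real_root LIMSEQ_Suc[OF suminf_exist_split2[OF sm]])
  ultimately have r_lim: "r \<longlonglongrightarrow> 0"
    unfolding r_def using tendsto_add[of x 0 sequentially "\<lambda>m. root n (W m)" "root n 0"] by simp
  \<comment> \<open>Chosen so that the geometric series with terms \<open>r 0 * q ^ m\<close> sums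
    to \<open>a\<close>; \<open>b m\<close> below is its partial sum, the position of block
    \<open>m\<close> on the diagonal.\<close>
  define q where "q = 1 - r 0 / a"
  have q: "0 < q" "q < 1" and ap: "0 < a"
    using r0a rpos[of 0] by (auto simp: q_def field_simps)
  define b where "b m = a * (1 - q ^ m)" for m
  have b_Suc: "b (Suc m) = b m + r 0 * q ^ m" for m
  proof -
    have r0: "r 0 = a * (1 - q)" using ap by (simp add: q_def)
    show ?thesis unfolding b_def r0 by (simp add: algebra_simps)
  qed
  have b_mono: "b m \<le> b m'" if "m \<le> m'" for m m'
    unfolding b_def using q ap that by (simp add: power_decreasing)
  have b0: "0 \<le> b m" for m using b_mono[of 0 m] by (simp add: b_def)
  have ba: "b m \<le> a" for m unfolding b_def using q ap by (simp add: algebra_simps)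
  have "(\<lambda>m. a * (1 - q ^ m)) \<longlonglongrightarrow> a * (1 - 0)"
    by (intro tendsto_intros LIMSEQ_power_zero) (use q in auto)
  then have b_lim: "b \<longlonglongrightarrow> a" by (simp add: b_def[abs_def])
  \<comment> \<open>\<open>N m\<close> is the start of block \<open>m\<close>, late enough for side
    \<open>r 0 * q ^ m\<close> to suffice; such a start exists since \<open>r\<close> tends to 0.
    The clause for \<open>m = 0\<close> ensures that the blocks cover all indices.\<close>
  have "\<exists>N :: nat \<Rightarrow> nat. \<forall>m. (r (N m) \<le> r 0 * q ^ m \<and> (m = 0 \<longrightarrow> N m = 0)) \<and> N m < N (Suc m)"
  proof (rule dependent_nat_choice)
    show "\<exists>N. r N \<le> r 0 * q ^ 0 \<and> ((0::nat) = 0 \<longrightarrow> N = 0)" by auto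
    fix N m :: nat
    have "0 < r 0 * q ^ Suc m" using rpos q by simp
    then have "\<forall>\<^sub>F M in sequentially. r M < r 0 * q ^ Suc m \<and> N < M"
      by (intro eventually_conj order_tendstoD(2)[OF r_lim] eventually_gt_at_top)
    then obtain M where "r M < r 0 * q ^ Suc m" "N < M"
      by (auto simp: eventually_sequentially)
    then show "\<exists>M. (r M \<le> r 0 * q ^ Suc m \<and> (Suc m = 0 \<longrightarrow> M = 0)) \<and> N < M"
      by (intro exI[of _ M]) auto
  qed
  then obtain N where rN: "\<And>m. r (N m) \<le> r 0 * q ^ m" and N0: "N 0 = 0"
    and NS: "\<And>m. N m < N (Suc m)" by blast
  have N_mono: "strict_mono N" by (rule strict_monoI_Suc) (rule NS)
  have "\<exists>p. cube_packing {N m..<N (Suc m)} (UNIV :: 'n set) x (\<lambda>_. r 0 * q ^ m) p" for m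
  proof (rule meir_moser[OF _ _ pos dec NS])
    have "x (N m) \<le> r (N m)" using W0[of "N m"] n by (simp add: r_def)
    with rN[of m] show "x (N m) \<le> r 0 * q ^ m" by simp
    have "W (N m) = root n (W (N m)) ^ n" using n W0 by simp
    also have "\<dots> \<le> (r 0 * q ^ m - x (N m)) ^ n"
      using rN[of m] W0[of "N m"] n by (intro power_mono) (auto simp: r_def)
    finally show "(\<Sum>j=N m..<N (Suc m). x j ^ CARD('n))
        \<le> x (N m) ^ CARD('n) + (\<Prod>i\<in>(UNIV :: 'n set). r 0 * q ^ m - x (N m))"
      using tail[OF NS[of m]] by (simp add: n_def)
  qed auto
  then obtain P where P: "\<And>m. cube_packing {N m..<N (Suc m)} (UNIV :: 'n set) x (\<lambda>_. r 0 * q ^ m) (P m)"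
    by metis
  \<comment> \<open>The number of the block that contains \<open>j\<close>.\<close>
  define B where "B j = (LEAST m. j < N (Suc m))" for j
  have ex: "j < N (Suc j)" for j using seq_suble[OF N_mono, of "Suc j"] by simp
  have B: "N (B j) \<le> j" "j < N (Suc (B j))" for j
  proof -
    show "j < N (Suc (B j))" unfolding B_def by (rule LeastI) (rule ex)
    show "N (B j) \<le> j"
    proof (cases "B j")
      case (Suc m)
      then have "\<not> j < N (Suc m)" unfolding B_def by (intro not_less_Least) simp
      then show ?thesis using Suc by simp
    qed (simp add: N0)
  qed
  have B_mono: "B j \<le> B j'" if "j \<le> j'" for j j'
    unfolding B_def[of j] by (rule Least_le) (use B(2)[of j'] that in simp)
  define p where "p j i = b (B j) + P (B j) j i" for j i
  have Pb: "0 \<le> P (B j) j i" "P (B j) j i + x j \<le> r 0 * q ^ B j" for j i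
    using cube_packing_bounds[OF P[of "B j"], of j i] B[of j] by simp_all
  have upper: "p j i + x j \<le> b (Suc (B j))" for j i
    using Pb(2)[of j i] by (simp add: p_def b_Suc)
  have lower: "b (B j) \<le> p j i" for j i using Pb(1) by (simp add: p_def)
  have "cube_packing UNIV UNIV x (\<lambda>_. a) p"
    unfolding cube_packing_def
  proof (intro conjI ballI impI)
    fix j i
    show "0 \<le> p j i" using lower[of j i] b0[of "B j"] by linarith
    show "p j i + x j \<le> a" using upper[of j i] ba[of "Suc (B j)"] by linarith
  next
    have sep: "\<exists>i\<in>UNIV. p j i + x j \<le> p j' i \<or> p j' i + x j' \<le> p j i" if "j < j'" for j j'
    proof (cases "B j = B j'")
      case True
      then show ?thesis
        using cube_packing_separated[OF P[of "B j"], of j j'] B[of j] B[of j'] that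
        by (auto simp: p_def)
    next
      case False
      \<comment> \<open>Cubes of different blocks are separated in every coordinate, because the
        blocks follow each other along the diagonal.\<close>
      then have "Suc (B j) \<le> B j'" using B_mono[of j j'] that by simp
      from b_mono[OF this] show ?thesis using upper[of j] lower[of j'] by (meson UNIV_I order_trans)
    qed
    fix j j' :: nat assume "j \<noteq> j'"
    then show "\<exists>i\<in>UNIV. p j i + x j \<le> p j' i \<or> p j' i + x j' \<le> p j i"
      using sep[of j j'] sep[of j' j] by (metis nat_neq_iff)
  qed
  moreover have "(\<lambda>j. p j i) \<longlonglongrightarrow> a" for i
  proof (rule tendsto_sandwich)
    have "filterlim B at_top sequentially"
      unfolding filterlim_at_top
    proof
      fix Z
      have "Z \<le> B j" if "N Z \<le> j" for j
        using B(2)[of j] that N_mono by (metis le_less_trans not_less_eq_eq not_le strict_mono_less)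
      then show "\<forall>\<^sub>F j in sequentially. Z \<le> B j" by (auto simp: eventually_sequentially)
    qed
    then show "(\<lambda>j. b (B j)) \<longlonglongrightarrow> a" by (rule filterlim_compose[OF b_lim])
    show "\<forall>\<^sub>F j in sequentially. b (B j) \<le> p j i" using lower by simp
    have "p j i \<le> a" for j using upper[of j i] ba[of "Suc (B j)"] pos[of j] by linarith
    then show "\<forall>\<^sub>F j in sequentially. p j i \<le> a" by simp
  qed simp
  ultimately show ?thesis by (rule that)
qed

section \<open>Closed sets that do not separate space\<close>

text \<open>The inside and the outside of \<open>Q\<close> both stay connected when the hole
  \<open>h\<close> is added, and they meet there. Any other point of \<open>- C\<close> is a
  frontier point, hence a limit of points of \<open>Q\<close>, and adding limit points preserves
  connectedness.\<close>

lemma connected_Compl_pierced_frontier: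
  fixes Q C :: "'a::euclidean_space set"
  assumes dim: "2 \<le> DIM('a)" and Q: "open Q" "convex Q" "bounded Q"
    and C: "C \<subseteq> frontier Q" and h: "h \<in> frontier Q" "h \<notin> C"
  shows "connected (- C)"
proof -
  have cl: "closure Q = Q \<union> frontier Q" and disj: "Q \<inter> frontier Q = {}"
    using Q(1) closure_subset[of Q] by (auto simp: frontier_def interior_open)
  have Q_ne: "Q \<noteq> {}" using h by auto
  \<comment> \<open>By convexity every frontier point is a limit of points outside
    \<open>closure Q\<close>; this lets \<open>h\<close> join the outside below.\<close>
  have int: "interior (closure Q) = Q"
    using Q by (simp add: convex_interior_closure interior_open)
  have "connected (- closure Q)"
    using Q dim by (intro connected_complement_bounded_convex) auto
  then have "connected (insert h (- closure Q))"
    by (rule connected_intermediate_closure)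
      (use h disj closure_subset[of "- closure Q"] in \<open>auto simp: closure_complement int\<close>)
  moreover have "connected (insert h Q)"
    by (rule connected_intermediate_closure[OF convex_connected[OF Q(2)]])
      (use h cl in auto)
  ultimately have conn: "connected (insert h Q \<union> insert h (- closure Q))"
    by (intro connected_Un) auto
  show ?thesis
  proof (rule connected_intermediate_closure[OF conn])
    show "insert h Q \<union> insert h (- closure Q) \<subseteq> - C"
      using C h cl disj by auto
    have "closure Q \<subseteq> closure (insert h Q \<union> insert h (- closure Q))"
      by (intro closure_mono) auto
    then show "- C \<subseteq> closure (insert h Q \<union> insert h (- closure Q))"
      using closure_subset[of "insert h Q \<union> insert h (- closure Q)"] by auto
  qed
qed

text \<open>Away from \<open>P\<close> only finitely many \<open>G j\<close> matter, and a finite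
  union of closed sets is closed.\<close>

lemma closure_UN_subset_insert_limit:
  fixes G :: "nat \<Rightarrow> 'a::metric_space set"
  assumes closed: "\<And>j. closed (G j)"
    and conv: "\<And>e. 0 < e \<Longrightarrow> \<forall>\<^sub>F j in sequentially. G j \<subseteq> cball P e"
  shows "closure (\<Union>j. G j) \<subseteq> insert P (\<Union>j. G j)"
proof
  fix y assume y: "y \<in> closure (\<Union>j. G j)"
  show "y \<in> insert P (\<Union>j. G j)"
  proof (cases "y = P")
    case False
    then have "0 < dist P y / 2" by simp
    from conv[OF this] obtain J where J: "\<And>j. J \<le> j \<Longrightarrow> G j \<subseteq> cball P (dist P y / 2)"
      by (auto simp: eventually_sequentially)
    have "(\<Union>j. G j) \<subseteq> (\<Union>j<J. G j) \<union> cball P (dist P y / 2)"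
    proof (rule UN_least)
      show "G j \<subseteq> (\<Union>j<J. G j) \<union> cball P (dist P y / 2)" for j
        using J[of j] by (cases "j < J") auto
    qed
    then have "closure (\<Union>j. G j) \<subseteq> (\<Union>j<J. G j) \<union> cball P (dist P y / 2)"
      by (intro closure_minimal closed_Un closed_UN) (auto intro: closed)
    with y False show ?thesis by auto
  qed simp
qed

text \<open>If the closure separated space, one of its components would. \<open>D j\<close> shields
  \<open>G j\<close> from the other pieces, so a component meeting \<open>G j\<close> lies in it and
  is covered by \<open>nonsep\<close>; a component meeting none is the point \<open>P\<close>, which
  does not separate in dimension at least two.\<close>

lemma connected_Compl_closure_UN:
  fixes G D :: "nat \<Rightarrow> 'a::euclidean_space set"
  assumes dim: "2 \<le> DIM('a)"
    and G: "\<And>j. closed (G j)" "\<And>j. G j \<subseteq> D j"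
    and D: "\<And>j. open (D j)" "\<And>i j. i \<noteq> j \<Longrightarrow> D i \<inter> D j = {}"
    and conv: "\<And>e. 0 < e \<Longrightarrow> \<forall>\<^sub>F j in sequentially. G j \<subseteq> cball P e"
    and nonsep: "\<And>j C. C \<subseteq> G j \<Longrightarrow> connected (- C)"
  shows "connected (- closure (\<Union>j. G j))"
proof (rule ccontr)
  let ?\<Gamma> = "closure (\<Union>j. G j)"
  assume "\<not> connected (- ?\<Gamma>)"
  then obtain C where C: "C \<in> components ?\<Gamma>" "\<not> connected (- C)"
    by (rule separation_by_component_closed[OF closed_closure])
  have "C \<inter> G j = {}" for j
  proof (rule ccontr)
    assume ne: "C \<inter> G j \<noteq> {}"
    \<comment> \<open>Inside the open set \<open>D j\<close> the closure contains nothing beyond the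
      closed set \<open>G j\<close>, so \<open>G j\<close> is relatively open as well as closed in
      \<open>?\<Gamma>\<close>.\<close>
    have "D j \<inter> ?\<Gamma> \<subseteq> closure (D j \<inter> (\<Union>j. G j))"
      by (rule open_Int_closure_subset[OF D(1)])
    also have "D j \<inter> (\<Union>j. G j) = G j"
    proof -
      have "D j \<inter> G i \<subseteq> G j" for i
        using G(2)[of i] D(2)[of j i] by (cases "i = j") auto
      then show ?thesis using G(2)[of j] by blast
    qed
    finally have sub: "D j \<inter> ?\<Gamma> \<subseteq> G j" using G(1) by (simp add: closure_closed)
    have "C \<subseteq> ?\<Gamma>" "connected C"
      using C(1) in_components_subset in_components_connected by auto
    \<comment> \<open>The open sets \<open>D j\<close> and \<open>- G j\<close> cover
      \<open>C\<close> and are disjoint on it.\<close>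
    then have "D j \<inter> C = {} \<or> - G j \<inter> C = {}"
      using sub by (intro connectedD D(1) open_Compl G(1)) (use G(2)[of j] in blast)+
    then have "C \<subseteq> G j" using ne G(2) by blast
    with nonsep C(2) show False by blast
  qed
  then have "C \<subseteq> {P}"
    using in_components_subset[OF C(1)] closure_UN_subset_insert_limit[OF G(1) conv] by blast
  then have "C = {P}" using in_components_nonempty[OF C(1)] by blast
  then show False using C(2) connected_punctured_universe[OF dim] by simp
qed

section \<open>Scaled cubes and pierced boundaries in terms of boxes\<close>

lemma mem_scale_translate_iff:
  "l \<noteq> 0 \<Longrightarrow> x \<in> scale_translate l S t \<longleftrightarrow> (1 / l) *\<^sub>R (x - t) \<in> S"
  unfolding scale_translate_def
  by (auto simp: image_iff intro!: bexI[of _ "(1 / l) *\<^sub>R (x - t)"])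

lemma scale_translate_open_unit_cube:
  "0 < l \<Longrightarrow> scale_translate l open_unit_cube t = box t (t + vec l)"
  by (auto simp: mem_scale_translate_iff open_unit_cube_def mem_box_cart field_simps)

lemma frontier_box_cart:
  fixes t :: "real ^ 'n"
  assumes "0 < l"
  shows "frontier (box t (t + vec l)) = cbox t (t + vec l) - box t (t + vec l)"
proof -
  have "t + (1/2) *\<^sub>R vec l \<in> box t (t + vec l)" using assms by (simp add: mem_box_cart)
  then have "box t (t + vec l) \<noteq> {}" by blast
  then show ?thesis by (simp add: frontier_def closure_box interior_open[OF open_box])
qed

lemma scale_translate_pierced_boundary:
  assumes "0 < l"
  shows "scale_translate l (pierced_boundary k \<epsilon>) t = frontier (box t (t + vec l)) -
    {x. x $ k = t $ k \<and> (\<forall>i. i \<noteq> k \<longrightarrow> t $ i < x $ i \<and> x $ i < t $ i + l * \<epsilon>)}"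
proof -
  have c: "open_unit_cube = box 0 (0 + vec 1 :: real ^ 'n)"
    by (auto simp: open_unit_cube_def mem_box_cart)
  show ?thesis
    unfolding pierced_boundary_def c using assms
    by (subst (1 2) frontier_box_cart)
      (auto simp: mem_scale_translate_iff mem_box_cart field_simps)
qed

text \<open>The removed window is flat, but the open set \<open>?U\<close> meets the frontier in the
  same points: as \<open>\<epsilon> < 1\<close>, a frontier point whose other coordinates lie in the
  window range is on the face \<open>x $ k = t $ k\<close> or the opposite one, and
  \<open>?U\<close> excludes the latter.\<close>

lemma closed_scale_translate_pierced_boundary:
  assumes "0 < l" "\<epsilon> < 1"
  shows "closed (scale_translate l (pierced_boundary k \<epsilon>) t)"
proof -
  let ?U = "{x. x $ k < t $ k + l \<and> (\<forall>i. i \<noteq> k \<longrightarrow> t $ i < x $ i \<and> x $ i < t $ i + l * \<epsilon>)}"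
  have "l * \<epsilon> < l" using assms by simp
  have "x $ k = t $ k \<longleftrightarrow> x $ k < t $ k + l"
    if "x \<in> frontier (box t (t + vec l))" and side: "\<forall>i. i \<noteq> k \<longrightarrow> t $ i < x $ i \<and> x $ i < t $ i + l * \<epsilon>" for x
  proof
    assume less: "x $ k < t $ k + l"
    have x: "\<And>i. t $ i \<le> x $ i" "x \<notin> box t (t + vec l)"
      using that(1) assms(1) by (auto simp: frontier_box_cart mem_box_cart)
    have "x \<in> box t (t + vec l)" if "t $ k < x $ k"
      unfolding mem_box_cart
    proof
      fix i
      show "t $ i < x $ i \<and> x $ i < (t + vec l) $ i"
      proof (cases "i = k")
        case False
        with side have "t $ i < x $ i" "x $ i < t $ i + l * \<epsilon>" by auto
        with \<open>l * \<epsilon> < l\<close> show ?thesis by simp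
      qed (use that less in simp)
    qed
    with x show "x $ k = t $ k" by (metis order_le_less)
  qed (use assms in simp)
  then have "scale_translate l (pierced_boundary k \<epsilon>) t = frontier (box t (t + vec l)) - ?U"
    unfolding scale_translate_pierced_boundary[OF assms(1)] by blast
  moreover have "open ({x. x $ k < t $ k + l} \<inter> (\<Inter>i\<in>-{k}. {x. t $ i < x $ i} \<inter> {x. x $ i < t $ i + l * \<epsilon>}))"
    by (intro open_Int open_INT open_Collect_less continuous_intros ballI) simp
  moreover have "\<dots> = ?U" by auto
  ultimately show ?thesis by (simp add: closed_Diff)
qed

section \<open>Choosing the translations and assembling the properties\<close>

theorem theorem1p9:
  fixes k :: "'n::finite" and \<epsilon> l :: "nat \<Rightarrow> real" and V a :: real
  assumes "CARD('n) \<ge> 2"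
    and "\<And>j. 0 < \<epsilon> j \<and> \<epsilon> j < 1"
    and "\<And>j. 0 < l j"
    and "decseq l"
    and "(\<lambda>j. l j ^ CARD('n)) sums V"
    and "a > l 0 + root CARD('n) (V - l 0 ^ CARD('n))"
  shows "\<exists>t :: nat \<Rightarrow> real ^ 'n.
    let Oj = (\<lambda>j. scale_translate (l j) open_unit_cube (t j));
        \<Gamma>j = (\<lambda>j. scale_translate (l j) (pierced_boundary k (\<epsilon> j)) (t j));
        Oinf = (\<Union>j. Oj j);
        \<Gamma> = closure (\<Union>j. \<Gamma>j j);
        \<Omega> = UNIV - \<Gamma>
    in (\<forall>i j. i \<noteq> j \<longrightarrow> closure (Oj i) \<inter> closure (Oj j) = {})
     \<and> (\<forall>i j. i \<noteq> j \<longrightarrow> \<Gamma>j i \<inter> \<Gamma>j j = {})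
     \<and> bounded Oinf \<and> \<Gamma> \<subseteq> frontier Oinf \<and> compact \<Gamma>
     \<and> connected \<Omega>
     \<and> Oinf \<subseteq> scale_translate a open_unit_cube 0"
proof -
  define n where "n = CARD('n)"
  define R where "R = l 0 + root n (V - l 0 ^ n)"
  have n: "0 < n" by (simp add: n_def)
  note lpos = assms(3)
  \<comment> \<open>The first term is at most the whole sum, so the root in \<open>R\<close> is of a
    nonnegative number and \<open>R\<close> is positive.\<close>
  have "(\<Sum>j\<in>{0}. l j ^ n) \<le> (\<Sum>j. l j ^ n)"
    using assms(5) lpos by (intro sum_le_suminf) (auto simp: n_def sums_iff less_imp_le)
  then have "l 0 ^ n \<le> V" using assms(5) by (simp add: n_def sums_iff)
  then have R: "0 < R" "R < a"
    using lpos[of 0] n assms(6) by (auto simp: R_def n_def intro: add_pos_nonneg)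
  \<comment> \<open>The midpoint between 1 and \<open>a / R\<close>. Enlarging all sides by
    \<open>c\<close> multiplies the bound \<open>R\<close> by \<open>c\<close>, which stays below
    \<open>a\<close>.\<close>
  define c where "c = (1 + a / R) / 2"
  have c: "1 < c" "c * R < a" using R by (auto simp: c_def field_simps)
  have "(\<lambda>j. (c * l j) ^ n) sums (c ^ n * V)"
    using sums_mult[OF assms(5), of "c ^ n"] by (simp add: power_mult_distrib n_def)
  moreover have "c * l 0 + root n (c ^ n * V - (c * l 0) ^ n) < a"
  proof -
    have "c ^ n * V - (c * l 0) ^ n = c ^ n * (V - l 0 ^ n)"
      by (simp add: power_mult_distrib algebra_simps)
    then have "root n (c ^ n * V - (c * l 0) ^ n) = c * root n (V - l 0 ^ n)"
      using c n by (simp add: real_root_mult real_root_power_cancel)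
    then show ?thesis using c by (simp add: R_def distrib_left)
  qed
  moreover have "decseq (\<lambda>j. c * l j)"
    using assms(4) c by (auto simp: decseq_def)
  moreover have "0 < c * l j" for j using c lpos by simp
  ultimately obtain p :: "nat \<Rightarrow> 'n \<Rightarrow> real"
    where p: "cube_packing UNIV UNIV (\<lambda>j. c * l j) (\<lambda>_. a) p"
      and plim: "\<And>i. (\<lambda>j. p j i) \<longlonglongrightarrow> a"
    using packing_to_corner[of "\<lambda>j. c * l j" "c ^ n * V" a] unfolding n_def by blast
  \<comment> \<open>Each cube is centred in its enlarged cube, with margin
    \<open>(c - 1) * l j / 2\<close> on every side; hence its closure lies in the open set
    \<open>D j\<close>.\<close>
  define t where "t j = (\<chi> i. p j i + (c - 1) * l j / 2)" for j
  define D where "D j = box (\<chi> i. p j i) (\<chi> i. p j i + c * l j)" for j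
  define Oj where "Oj j = box (t j) (t j + vec (l j))" for j
  define \<Gamma>j where "\<Gamma>j j = scale_translate (l j) (pierced_boundary k (\<epsilon> j)) (t j)" for j
  define Oinf where "Oinf = (\<Union>j. Oj j)"
  define \<Gamma> where "\<Gamma> = closure (\<Union>j. \<Gamma>j j)"
  have Oj_eq: "scale_translate (l j) open_unit_cube (t j) = Oj j" for j
    using lpos by (simp add: Oj_def scale_translate_open_unit_cube)
  have front: "frontier (Oj j) = cbox (t j) (t j + vec (l j)) - Oj j" for j
    using frontier_box_cart[OF lpos] by (simp add: Oj_def)
  have clO: "closure (Oj j) = cbox (t j) (t j + vec (l j))" for j
  proof -
    have "t j + (1/2) *\<^sub>R vec (l j) \<in> Oj j" using lpos by (simp add: Oj_def mem_box_cart)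
    then show ?thesis unfolding Oj_def by (intro closure_box) blast
  qed
  have clD: "closure (Oj j) \<subseteq> D j" for j
  proof -
    define u where "u = (c - 1) * l j"
    have u: "0 < u" "c * l j = u + l j"
      using c lpos by (simp_all add: u_def algebra_simps)
    have "p j i < y \<and> y < p j i + c * l j" if "p j i + u / 2 \<le> y \<and> y \<le> p j i + u / 2 + l j" for i y
      using that u by (intro conjI) linarith+
    then show ?thesis
      unfolding clO by (auto simp: D_def t_def u_def[symmetric] mem_box_cart)
  qed
  have openD: "open (D j)" for j
    by (simp add: D_def open_box)
  have D_disj: "D i \<inter> D j = {}" if ij: "i \<noteq> j" for i j
  proof -
    obtain m where m: "p i m + c * l i \<le> p j m \<or> p j m + c * l j \<le> p i m"
      using cube_packing_separated[OF p UNIV_I UNIV_I ij] by blast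
    have b: "p i m < y $ m" "y $ m < p i m + c * l i" if "y \<in> D i" for y i
      using that by (simp_all add: D_def mem_box_cart)
    have "y \<notin> D i \<or> y \<notin> D j" for y
      using m b[of y i] b[of y j] by linarith
    then show ?thesis by blast
  qed
  have O_disj: "closure (Oj i) \<inter> closure (Oj j) = {}" if "i \<noteq> j" for i j
    using D_disj[OF that] clD by blast
  have \<Gamma>_front: "\<Gamma>j j \<subseteq> frontier (Oj j)" for j
    unfolding \<Gamma>j_def Oj_def scale_translate_pierced_boundary[OF lpos] by (rule Diff_subset)
  have \<Gamma>_cl: "\<Gamma>j j \<subseteq> closure (Oj j)" for j
    using \<Gamma>_front[of j] by (auto simp: frontier_def)
  have DA: "D j \<subseteq> box 0 (vec a)" for j
  proof -
    have "0 \<le> p j i" "p j i + c * l j \<le> a" for i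
      using p by (auto simp: cube_packing_def)
    then have "0 < y \<and> y < a" if "p j i < y \<and> y < p j i + c * l j" for i y
      using that by (meson le_less_trans less_le_trans)
    then show ?thesis unfolding subset_iff D_def mem_box_cart
      by (simp only: vec_lambda_beta zero_index vec_component) blast
  qed
  have Oinf_sub: "Oinf \<subseteq> box 0 (vec a)"
    unfolding Oinf_def by (intro UN_least order_trans[OF closure_subset order_trans[OF clD DA]])
  have bdd: "bounded Oinf" by (rule bounded_subset[OF bounded_box Oinf_sub])
  have opO: "open Oinf" by (auto simp: Oinf_def Oj_def)
  \<comment> \<open>A point of \<open>\<Gamma>j j\<close> lies in the closure of \<open>Oinf\<close>
    but in no open cube: cube \<open>j\<close> misses its own frontier, and the other cubes have
    closures disjoint from that of cube \<open>j\<close>.\<close>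
  have "\<Gamma>j j \<subseteq> frontier Oinf" for j
  proof -
    have "closure (Oj j) \<subseteq> closure Oinf" by (intro closure_mono) (auto simp: Oinf_def)
    moreover have "\<Gamma>j j \<inter> Oj i = {}" for i
      using \<Gamma>_front[of j] front[of j] O_disj[of i j] \<Gamma>_cl[of j] closure_subset[of "Oj i"]
      by (cases "i = j") auto
    ultimately show ?thesis
      using opO \<Gamma>_cl[of j] by (auto simp: frontier_def interior_open Oinf_def)
  qed
  then have \<Gamma>_sub: "\<Gamma> \<subseteq> frontier Oinf"
    unfolding \<Gamma>_def by (intro closure_minimal) auto
  have "compact \<Gamma>"
    using bounded_subset[OF compact_imp_bounded[OF compact_frontier_bounded[OF bdd]] \<Gamma>_sub]
    by (simp add: \<Gamma>_def compact_eq_bounded_closed)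
  have "connected (- \<Gamma>)"
    unfolding \<Gamma>_def
  proof (rule connected_Compl_closure_UN[where D = D and P = "vec a"])
    show "2 \<le> DIM(real ^ 'n)" using assms(1) by simp
    show "closed (\<Gamma>j j)" for j
      unfolding \<Gamma>j_def using lpos assms(2) by (intro closed_scale_translate_pierced_boundary) auto
    show "\<Gamma>j j \<subseteq> D j" for j using \<Gamma>_cl clD by blast
    show "\<forall>\<^sub>F j in sequentially. \<Gamma>j j \<subseteq> cball (vec a) e" if e: "0 < e" for e
    proof -
      \<comment> \<open>A tolerance of \<open>e / n\<close> in each coordinate adds up to
        \<open>e\<close> in the sum norm, which bounds the Euclidean norm.\<close>
      have "\<forall>\<^sub>F j in sequentially. \<forall>i. a - e / n < p j i"
        by (intro eventually_all_finite order_tendstoD(1)[OF plim]) (use e n in simp)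
      then show ?thesis
      proof eventually_elim
        case (elim j)
        show ?case
        proof
          fix y assume "y \<in> \<Gamma>j j"
          then have y: "y \<in> D j" using \<Gamma>_cl clD by blast
          then have "y \<in> box 0 (vec a)" using DA by blast
          with y have "p j i < y $ i" "y $ i < a" for i by (simp_all add: D_def mem_box_cart)
          then have "\<bar>(vec a - y) $ i\<bar> \<le> e / n" for i
            using elim[rule_format, of i] by (smt (verit) vec_component vector_minus_component)
          then have "(\<Sum>i\<in>UNIV. \<bar>(vec a - y) $ i\<bar>) \<le> (\<Sum>i\<in>(UNIV :: 'n set). e / n)"
            by (intro sum_mono)
          also have "\<dots> = e" using n by (simp add: n_def)
          finally show "y \<in> cball (vec a) e"
            using norm_le_l1_cart[of "vec a - y"] by (simp add: dist_norm)
        qed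
      qed
    qed
    show "connected (- C)" if C: "C \<subseteq> \<Gamma>j j" for C j
    proof (rule connected_Compl_pierced_frontier[of "Oj j"])
      \<comment> \<open>The centre of the window removed from the face.\<close>
      let ?h = "t j + (\<chi> i. if i = k then 0 else l j * \<epsilon> j / 2)"
      have e: "0 < l j * \<epsilon> j" "l j * \<epsilon> j < l j" "0 < l j"
        using lpos[of j] assms(2)[of j] by auto
      then show "?h \<in> frontier (Oj j)"
        unfolding front by (auto simp: Oj_def mem_box_cart)
      have "?h \<notin> \<Gamma>j j"
        using e assms(2)[of j] by (auto simp: \<Gamma>j_def scale_translate_pierced_boundary)
      then show "?h \<notin> C" using C by blast
    qed (use assms(1) C \<Gamma>_front in \<open>auto simp: Oj_def bounded_box\<close>)
  qed (use openD D_disj in auto)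
  moreover have "\<Gamma>j i \<inter> \<Gamma>j j = {}" if "i \<noteq> j" for i j
    using O_disj[OF that] \<Gamma>_cl by blast
  moreover have "scale_translate a open_unit_cube 0 = box 0 (vec a :: real ^ 'n)"
    using R by (simp add: scale_translate_open_unit_cube)
  ultimately show ?thesis
    using O_disj bdd \<Gamma>_sub \<open>compact \<Gamma>\<close> Oinf_sub
    unfolding Let_def
    by (intro exI[of _ t])
      (simp add: Oj_eq \<Gamma>j_def[symmetric] Oinf_def[symmetric] \<Gamma>_def[symmetric] Compl_eq_Diff_UNIV[symmetric])
qed

end
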